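(* Let $K$ be a field, $P=K[x_1,\dots,x_n]$, and $\mathfrak{M}=\langle x_1,\dots,x_n\rangle$. Let $g_1,\dots,g_r\in\mathfrak{M}$, let $I=\langle g_1,\dots,g_r\rangle$, let $Z=(z_1,\dots,z_s)$ be a tuple of distinct indeterminates in $(x_1,\dots,x_n)$, and let $A\in\mathrm{Mat}_{r,n}(K)$ be the coefficient matrix of $(\mathrm{Lin}_{\mathfrak{M}}(g_1),\dots,\mathrm{Lin}_{\mathfrak{M}}(g_r))$. If $Z$ is a separating tuple of indeterminates for $I$, then the submatrix $A'\in\mathrm{Mat}_{r,s}(K)$ of $A$ which consists of the columns corresponding to the indeterminates in $Z$ has rank $s$. In particular, we have $s\le\dim_K(\mathrm{Lin}_{\mathfrak{M}}(I))$.
   Context: For $f\in\mathfrak{M}$, $\mathrm{Lin}_{\mathfrak{M}}(f)$ is the linear part of $f$, i.e. its homogeneous component of standard degree $1$. $\mathrm{Lin}_{\mathfrak{M}}(I)$ is the $K$-vector space generated by the linear parts of the polynomials in $I$. The coefficient matrix of a tuple of linear forms $(\ell_1,\dots,\ell_r)$ with $\ell_i=a_{i1}x_1+\cdots+a_{in}x_n$ is $(a_{ij})\in\mathrm{Mat}_{r,n}(K)$. A tuple $F=(f_1,\dots,f_s)\in P^s$ is $Z$-separating if there exists a term ordering $\sigma$ such that the leading term (power product) satisfies $\mathrm{LT}_\sigma(f_i)=z_i$ for $i=1,\dots,s$. $Z$ is called a separating tuple of indeterminates for $I$ if $I$ contains a $Z$-separating tuple of polynomials. *)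

theory Defs
  imports "HOL-Library.Poly_Mapping" "HOL-Algebra.Ideal" "Jordan_Normal_Form.DL_Rank"
begin

text \<open>
  Indeterminates are numbered from 0: a power product is its exponent function, and the
  ring in the indeterminates with numbers \<open>0, \<dots>, n - 1\<close> is a carrier set in the type of
  polynomials in countably many indeterminates.
\<close>

type_synonym power_product = "nat \<Rightarrow>\<^sub>0 nat"
type_synonym 'k mpoly = "power_product \<Rightarrow>\<^sub>0 'k"

definition power_products :: "nat \<Rightarrow> power_product set" where
  "power_products n = {t. Poly_Mapping.keys t \<subseteq> {..<n}}"

definition poly_ring :: "nat \<Rightarrow> ('k::field mpoly) ring" where
  "poly_ring n =
     \<lparr>carrier = {f. Poly_Mapping.keys f \<subseteq> power_products n},
      mult = (*), one = 1, zero = 0, add = (+)\<rparr>"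

lemma cring_poly_ring: "cring (poly_ring n :: ('k::field mpoly) ring)"
proof (rule cringI)
  have add: "s + t \<in> power_products n"
    if "s \<in> power_products n" "t \<in> power_products n" for s t
    using that Poly_Mapping.keys_add[of s t] by (auto simp: power_products_def)
  show "abelian_group (poly_ring n :: ('k mpoly) ring)"
  proof (rule abelian_groupI)
    fix f :: "'k mpoly" assume "f \<in> carrier (poly_ring n)"
    then show "\<exists>g \<in> carrier (poly_ring n). g \<oplus>\<^bsub>poly_ring n\<^esub> f = \<zero>\<^bsub>poly_ring n\<^esub>"
      by (intro bexI[of _ "- f"]) (auto simp: poly_ring_def)
  next
    fix f g :: "'k mpoly"
    assume "f \<in> carrier (poly_ring n)" "g \<in> carrier (poly_ring n)"
    then show "f \<oplus>\<^bsub>poly_ring n\<^esub> g \<in> carrier (poly_ring n)"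
      using Poly_Mapping.keys_add[of f g] by (auto simp: poly_ring_def)
  qed (auto simp: poly_ring_def algebra_simps)
  show "comm_monoid (poly_ring n :: ('k mpoly) ring)"
  proof (rule comm_monoidI)
    fix f g :: "'k mpoly"
    assume "f \<in> carrier (poly_ring n)" "g \<in> carrier (poly_ring n)"
    then show "f \<otimes>\<^bsub>poly_ring n\<^esub> g \<in> carrier (poly_ring n)"
      using Poly_Mapping.keys_mult[of f g] add by (fastforce simp: poly_ring_def)
  qed (auto simp: poly_ring_def algebra_simps power_products_def)
qed (auto simp: poly_ring_def algebra_simps)

definition indet_pp :: "nat \<Rightarrow> power_product" where
  "indet_pp j = Poly_Mapping.single j 1"

definition indet :: "nat \<Rightarrow> 'k::field mpoly" where
  "indet j = Poly_Mapping.single (indet_pp j) 1"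

definition irrelevant_ideal :: "nat \<Rightarrow> ('k::field mpoly) set" where
  "irrelevant_ideal n = Idl\<^bsub>poly_ring n\<^esub> (indet ` {..<n})"

definition pp_degree :: "power_product \<Rightarrow> nat" where
  "pp_degree t = (\<Sum>j\<in>Poly_Mapping.keys t. Poly_Mapping.lookup t j)"

definition hom_component :: "nat \<Rightarrow> 'k::field mpoly \<Rightarrow> 'k mpoly" where
  "hom_component d f =
     (\<Sum>t\<in>{t \<in> Poly_Mapping.keys f. pp_degree t = d}.
        Poly_Mapping.single t (Poly_Mapping.lookup f t))"

definition Lin :: "'k::field mpoly \<Rightarrow> 'k mpoly" where
  "Lin f = hom_component 1 f"

definition scalar_mult :: "'k::field \<Rightarrow> 'k mpoly \<Rightarrow> 'k mpoly" where
  "scalar_mult c f = Poly_Mapping.map ((*) c) f"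

lemma lookup_scalar_mult: "Poly_Mapping.lookup (scalar_mult c f) t = c * Poly_Mapping.lookup f t"
  by (simp add: scalar_mult_def Poly_Mapping.map.rep_eq when_def)

lemma vector_space_scalar_mult: "vector_space (scalar_mult :: 'k::field \<Rightarrow> 'k mpoly \<Rightarrow> 'k mpoly)"
  by unfold_locales
    (auto intro!: poly_mapping_eqI simp: lookup_scalar_mult lookup_add algebra_simps)

definition Lin_space :: "('k::field mpoly) set \<Rightarrow> ('k mpoly) set" where
  "Lin_space I = module.span scalar_mult (Lin ` I)"

definition coeff_mat :: "nat \<Rightarrow> ('k::field mpoly) list \<Rightarrow> 'k mat" where
  "coeff_mat n ls = mat (length ls) n (\<lambda>(i, j). Poly_Mapping.lookup (ls ! i) (indet_pp j))"

definition term_ordering :: "nat \<Rightarrow> power_product rel \<Rightarrow> bool" where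
  "term_ordering n \<sigma> \<longleftrightarrow>
     linear_order_on (power_products n) \<sigma> \<and>
     (\<forall>t\<in>power_products n. (0, t) \<in> \<sigma>) \<and>
     (\<forall>s t. \<forall>u\<in>power_products n. (s, t) \<in> \<sigma> \<longrightarrow> (s + u, t + u) \<in> \<sigma>)"

text \<open>The leading term, meant for nonzero \<open>f\<close> only; \<open>(s, t) \<in> \<sigma>\<close> reads \<open>s \<le> t\<close>.\<close>

definition LT :: "power_product rel \<Rightarrow> 'k::field mpoly \<Rightarrow> power_product" where
  "LT \<sigma> f = (THE t. t \<in> Poly_Mapping.keys f \<and> (\<forall>s\<in>Poly_Mapping.keys f. (s, t) \<in> \<sigma>))"

text \<open>A tuple of indeterminates is the list of their numbers.\<close>

definition Z_separating :: "nat \<Rightarrow> nat list \<Rightarrow> ('k::field mpoly) list \<Rightarrow> bool" where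
  "Z_separating n zs fs \<longleftrightarrow>
     length fs = length zs \<and> set fs \<subseteq> carrier (poly_ring n) \<and>
     (\<exists>\<sigma>. term_ordering n \<sigma> \<and>
        (\<forall>i<length zs. fs ! i \<noteq> 0 \<and> LT \<sigma> (fs ! i) = indet_pp (zs ! i)))"

definition separating_tuple :: "nat \<Rightarrow> nat list \<Rightarrow> ('k::field mpoly) set \<Rightarrow> bool" where
  "separating_tuple n zs I \<longleftrightarrow> (\<exists>fs. set fs \<subseteq> I \<and> Z_separating n zs fs)"

end

theory Submission
  imports Defs
begin

text \<open>
  The polynomials of \<open>\<MM>\<close> whose linear part is killed by a linear form in the coefficients
  form an ideal, because \<open>Lin (h f) = h(0) Lin f\<close> for \<open>f \<in> \<MM>\<close>. Hence a vector in the kernel of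
  \<open>A'\<close>, which gives a linear form killing the linear parts of the generators, also kills those of
  the separating polynomials. The coefficients of the latter at the indeterminates of \<open>Z\<close> form a
  matrix that is triangular for the term ordering, with nonzero diagonal, so this vector is zero.
  The same triangular shape makes the linear parts of the separating polynomials independent.
\<close>

section \<open>Linear algebra\<close>

text \<open>Take \<open>i\<close> minimal for \<open>R\<close> in the support of \<open>v\<close>:
  row \<open>i\<close> then reduces to \<open>M i i * v i = 0\<close>. An abstract strict order
  \<open>R\<close> on the indices replaces the usual numbering, so that a term ordering, or its
  converse for the transposed matrix, can be used without sorting.\<close>

lemma triangular_kernel:
  fixes M :: "'i \<Rightarrow> 'i \<Rightarrow> 'a::idom"
  assumes "finite S" "asymp_on S R" "transp_on S R"
    and diag: "\<And>i. i \<in> S \<Longrightarrow> M i i \<noteq> 0"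
    and tri: "\<And>i j. i \<in> S \<Longrightarrow> j \<in> S \<Longrightarrow> i \<noteq> j \<Longrightarrow> M i j \<noteq> 0 \<Longrightarrow> R j i"
    and ker: "\<And>i. i \<in> S \<Longrightarrow> (\<Sum>j\<in>S. M i j * v j) = 0"
    and "k \<in> S"
  shows "v k = 0"
proof (rule ccontr)
  assume "v k \<noteq> 0"
  define T where "T = {i \<in> S. v i \<noteq> 0}"
  have "T \<subseteq> S" "T \<noteq> {}" "finite T"
    using \<open>v k \<noteq> 0\<close> \<open>k \<in> S\<close> \<open>finite S\<close> by (auto simp: T_def)
  then have "\<exists>i\<in>T. \<forall>j\<in>T. j \<noteq> i \<longrightarrow> \<not> R j i"
    by (intro Finite_Set.bex_min_element asymp_on_subset[OF assms(2)] transp_on_subset[OF assms(3)])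
  then obtain i where i: "i \<in> T" "\<And>j. j \<in> T \<Longrightarrow> j \<noteq> i \<Longrightarrow> \<not> R j i"
    by blast
  then have "i \<in> S" "v i \<noteq> 0" by (auto simp: T_def)
  \<comment> \<open>If \<open>v j\<close> is nonzero then \<open>j\<close> lies in \<open>T\<close>,
    so minimality of \<open>i\<close> excludes \<open>R j i\<close>, and \<open>tri\<close> forces
    \<open>M i j = 0\<close>.\<close>
  have "M i j * v j = 0" if "j \<in> S - {i}" for j
    using that tri[of i j] i(2)[of j] \<open>i \<in> S\<close> by (auto simp: T_def)
  then have "(\<Sum>j\<in>S - {i}. M i j * v j) = 0" by (rule sum.neutral[OF ballI])
  then have "(\<Sum>j\<in>S. M i j * v j) = M i i * v i"
    using \<open>i \<in> S\<close> \<open>finite S\<close> by (simp add: sum.remove)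
  with ker[OF \<open>i \<in> S\<close>] diag[OF \<open>i \<in> S\<close>] \<open>v i \<noteq> 0\<close> show False by simp
qed

text \<open>Independence is a property of sets, which forgets repetitions. Equal members
  \<open>f i = f j\<close> would satisfy a relation with coefficients 1 and -1, so the family is
  injective and its image has as many elements as \<open>S\<close>.\<close>

lemma (in vector_space) independent_family:
  fixes f :: "'i \<Rightarrow> 'b"
  assumes "finite S"
    and rel: "\<And>c i. (\<Sum>i\<in>S. scale (c i) (f i)) = 0 \<Longrightarrow> i \<in> S \<Longrightarrow> c i = 0"
  shows "inj_on f S" "independent (f ` S)"
proof -
  show inj: "inj_on f S"
  proof (rule inj_onI, rule ccontr)
    fix i j assume ij: "i \<in> S" "j \<in> S" "f i = f j" "i \<noteq> j"
    define c :: "'i \<Rightarrow> 'a" where "c k = (if k = i then 1 else if k = j then -1 else 0)" for k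
    have "(\<Sum>k\<in>S. scale (c k) (f k)) = (\<Sum>k\<in>{i,j}. scale (c k) (f k))"
      using \<open>finite S\<close> ij by (intro sum.mono_neutral_right) (auto simp: c_def)
    also have "\<dots> = 0" using ij by (simp add: c_def)
    finally show False using rel[of c i] ij by (simp add: c_def)
  qed
  show "independent (f ` S)"
  proof
    assume "dependent (f ` S)"
    then obtain u where u: "\<exists>v\<in>f ` S. u v \<noteq> 0" "(\<Sum>v\<in>f ` S. scale (u v) v) = 0"
      using dependent_finite[of "f ` S"] \<open>finite S\<close> by auto
    then have "(\<Sum>i\<in>S. scale (u (f i)) (f i)) = 0"
      by (simp add: sum.reindex[OF inj])
    with u(1) rel[of "\<lambda>i. u (f i)"] show False by auto
  qed
qed

text \<open>The bound by a finite set is needed because \<open>dim\<close> is \<open>0\<close> on infinite-dimensional spaces.\<close>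

lemma (in vector_space) card_le_dim:
  assumes "independent S" "S \<subseteq> V" "V \<subseteq> span T" "finite T"
  shows "card S \<le> dim V"
proof -
  obtain B where B: "B \<subseteq> V" "independent B" "V \<subseteq> span B" "card B = dim V"
    by (rule basis_exists)
  have "finite B"
    using independent_span_bound[OF \<open>finite T\<close> B(2)] B(1) assms(3) by blast
  from independent_span_bound[OF this assms(1)] show ?thesis
    using assms(2) B(3,4) by auto
qed

text \<open>The criterion for full rank through independent columns asks for distinct columns. Equal
  columns \<open>i\<close> and \<open>j\<close> would put the difference of two unit vectors into
  the kernel; a dependence among distinct columns gives a nonzero kernel vector directly.\<close>

lemma (in vec_space) trivial_kernel_full_rank:
  assumes A: "A \<in> carrier_mat n nc"
    and ker: "\<And>v. v \<in> carrier_vec nc \<Longrightarrow> A *\<^sub>v v = 0\<^sub>v n \<Longrightarrow> v = 0\<^sub>v nc"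
  shows "rank A = nc"
proof -
  have dist: "distinct (cols A)"
  proof (rule ccontr)
    assume "\<not> distinct (cols A)"
    then obtain i j where ij: "i < nc" "j < nc" "i \<noteq> j" "col A i = col A j"
      using A by (auto simp: distinct_conv_nth)
    have "A *\<^sub>v (unit_vec nc i - unit_vec nc j) = col A i - col A j"
      using A ij(1,2) by (intro eq_vecI) (simp_all add: mult_minus_distrib_mat_vec)
    also have "\<dots> = 0\<^sub>v n"
      unfolding ij(4) using A ij(2) by (intro eq_vecI) auto
    finally have "unit_vec nc i - unit_vec nc j = (0\<^sub>v nc :: 'a vec)"
      by (intro ker) auto
    then have "(unit_vec nc i - unit_vec nc j :: 'a vec) $ i = 0"
      using ij by simp
    then show False using ij by simp
  qed
  show ?thesis
    using lin_indpt_full_rank[OF A dist] lin_depE[OF A _ dist] ker by metis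
qed

section \<open>Linear coefficients of polynomials\<close>

lemma indet_pp_eq_iff [simp]: "indet_pp i = indet_pp j \<longleftrightarrow> i = j"
  unfolding indet_pp_def by (metis lookup_single_eq lookup_single_not_eq zero_neq_one)

lemma indet_pp_neq_0 [simp]: "indet_pp j \<noteq> 0"
  unfolding indet_pp_def by (metis lookup_single_eq lookup_zero zero_neq_one)

lemma indet_pp_in_power_products [simp]: "indet_pp j \<in> power_products n \<longleftrightarrow> j < n"
  by (simp add: indet_pp_def power_products_def)

lemma pp_degree_eq_1_iff: "pp_degree t = 1 \<longleftrightarrow> (\<exists>j. t = indet_pp j)"
proof
  assume "pp_degree t = 1"
  then obtain j where j: "Poly_Mapping.lookup t j = 1"
      "\<And>k. k \<in> Poly_Mapping.keys t \<Longrightarrow> j \<noteq> k \<Longrightarrow> Poly_Mapping.lookup t k = 0"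
    unfolding pp_degree_def sum_eq_1_iff[OF finite_keys] by (elim bexE conjE) (rule that; blast)
  then have "t = indet_pp j"
    by (intro poly_mapping_eqI)
      (auto simp: indet_pp_def lookup_single when_def in_keys_iff)
  then show "\<exists>j. t = indet_pp j" ..
qed (auto simp: pp_degree_def indet_pp_def)

lemma lookup_hom_component:
  "Poly_Mapping.lookup (hom_component d f) t = (Poly_Mapping.lookup f t when pp_degree t = d)"
  by (auto simp: hom_component_def lookup_sum lookup_single when_def in_keys_iff sum.If_cases
      intro!: sum.neutral)

lemma lookup_Lin_indet_pp [simp]:
  "Poly_Mapping.lookup (Lin f) (indet_pp j) = Poly_Mapping.lookup f (indet_pp j)"
  using pp_degree_eq_1_iff[of "indet_pp j"] by (simp add: Lin_def lookup_hom_component)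

text \<open>Exponents are natural numbers, so a sum of 1 at \<open>j\<close> and 0 elsewhere leaves
  one summand with no exponents at all.\<close>

lemma add_eq_indet_pp:
  assumes "indet_pp j = s + t"
  shows "s = 0 \<and> t = indet_pp j \<or> s = indet_pp j \<and> t = 0"
proof -
  have eq: "Poly_Mapping.lookup s k + Poly_Mapping.lookup t k = (if k = j then 1 else 0)" for k
    using arg_cong[OF assms, of "\<lambda>p. Poly_Mapping.lookup p k"]
    by (auto simp: indet_pp_def lookup_add lookup_single when_def)
  have "s = 0 \<or> t = 0"
  proof (cases "Poly_Mapping.lookup s j = 0")
    case True
    then have "Poly_Mapping.lookup s k = 0" for k
      using eq[of k] by (cases "k = j") auto
    then show ?thesis by (auto intro: poly_mapping_eqI)
  next
    case False
    then have "Poly_Mapping.lookup t k = 0" for k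
      using eq[of k] by (cases "k = j") auto
    then show ?thesis by (auto intro: poly_mapping_eqI)
  qed
  then show ?thesis using assms by auto
qed

lemma Sum_any_eq_single:
  assumes "\<And>x. x \<noteq> a \<Longrightarrow> g x = 0"
  shows "Sum_any g = g a"
  using Sum_any.expand_superset[of "{a}" g] assms by auto

lemma lookup_mult_0:
  fixes f g :: "'k::field mpoly"
  shows "Poly_Mapping.lookup (f * g) 0 = Poly_Mapping.lookup f 0 * Poly_Mapping.lookup g 0"
proof -
  have zero: "0 = s + t \<longleftrightarrow> s = 0 \<and> t = 0" for s t :: power_product
    by (auto simp: poly_mapping_eq_iff fun_eq_iff lookup_add)
  show ?thesis
    unfolding lookup_mult zero
    by (subst Sum_any_eq_single[of 0]; simp add: Sum_any_eq_single[of 0])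
qed

text \<open>This is the Leibniz rule at the origin: taking the coefficient at
  \<open>indet_pp j\<close> is a derivation over evaluation at 0. For \<open>g\<close> without
  constant term only the first summand survives.\<close>

lemma lookup_mult_indet_pp:
  fixes f g :: "'k::field mpoly"
  shows "Poly_Mapping.lookup (f * g) (indet_pp j) =
    Poly_Mapping.lookup f 0 * Poly_Mapping.lookup g (indet_pp j) +
    Poly_Mapping.lookup f (indet_pp j) * Poly_Mapping.lookup g 0"
proof -
  \<comment> \<open>The inner sum of the convolution; it can be nonzero only at the two divisors of
    the indeterminate.\<close>
  let ?in = "\<lambda>s. \<Sum>t. Poly_Mapping.lookup g t when indet_pp j = s + t"
  have "?in 0 = Poly_Mapping.lookup g (indet_pp j)"
    by (subst Sum_any_eq_single[of "indet_pp j"]) auto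
  moreover have "?in (indet_pp j) = Poly_Mapping.lookup g 0"
    by (subst Sum_any_eq_single[of 0]) (auto simp: when_def)
  moreover have "?in s = 0" if "s \<notin> {0, indet_pp j}" for s
    using that add_eq_indet_pp[of j s] by (subst Sum_any_eq_single[of 0]) (auto simp: when_def)
  then have "Poly_Mapping.lookup (f * g) (indet_pp j) =
      (\<Sum>s\<in>{0, indet_pp j}. Poly_Mapping.lookup f s * ?in s)"
    unfolding lookup_mult by (intro Sum_any.expand_superset) auto
  ultimately show ?thesis
    using indet_pp_neq_0[of j] by simp
qed

section \<open>Ideals defined by a condition on linear parts\<close>

text \<open>The vector \<open>v\<close> acts as a linear functional on the linear coefficients at
  the indeterminates \<open>z i\<close>. The condition on the constant term makes the set closed
  under multiplication by arbitrary polynomials.\<close>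

definition lin_form_kernel ::
    "nat \<Rightarrow> 'i set \<Rightarrow> ('i \<Rightarrow> nat) \<Rightarrow> ('i \<Rightarrow> 'k) \<Rightarrow> ('k::field mpoly) set" where
  "lin_form_kernel n S z v =
     {f \<in> carrier (poly_ring n). Poly_Mapping.lookup f 0 = 0 \<and>
        (\<Sum>i\<in>S. Poly_Mapping.lookup f (indet_pp (z i)) * v i) = 0}"

lemma ideal_lin_form_kernel:
  "ideal (lin_form_kernel n S z v) (poly_ring n :: ('k::field mpoly) ring)"
    (is "ideal ?J ?P")
proof -
  interpret cring ?P by (rule cring_poly_ring)
  have ops: "f \<oplus>\<^bsub>?P\<^esub> g = f + g" "f \<otimes>\<^bsub>?P\<^esub> g = f * g" "\<zero>\<^bsub>?P\<^esub> = 0" for f g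
    by (simp_all add: poly_ring_def)
  have minus: "\<ominus>\<^bsub>?P\<^esub> f = - f" if "f \<in> carrier ?P" for f
  proof (rule minus_equality)
    show "- f \<in> carrier ?P" using that by (simp add: poly_ring_def)
  qed (use that in \<open>simp_all add: ops\<close>)
  \<comment> \<open>As \<open>f\<close> has no constant term, multiplying by \<open>g\<close> scales
    its linear coefficients by the constant term of \<open>g\<close>, so the functional still
    vanishes.\<close>
  have mult: "g \<otimes>\<^bsub>?P\<^esub> f \<in> ?J" if "f \<in> ?J" "g \<in> carrier ?P" for f g
  proof -
    have "Poly_Mapping.lookup f 0 = 0" using that(1) by (simp add: lin_form_kernel_def)
    then have "(\<Sum>i\<in>S. Poly_Mapping.lookup (g * f) (indet_pp (z i)) * v i) =
        Poly_Mapping.lookup g 0 * (\<Sum>i\<in>S. Poly_Mapping.lookup f (indet_pp (z i)) * v i)"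
      by (simp add: lookup_mult_indet_pp sum_distrib_left mult.assoc)
    with that m_closed[of g f] show ?thesis
      by (simp add: lin_form_kernel_def ops lookup_mult_0)
  qed
  show ?thesis
  proof (rule idealI)
    show "subgroup ?J (add_monoid ?P)"
    proof (rule group.subgroupI)
      show "group (add_monoid ?P)" by (rule a_group)
      show "?J \<subseteq> carrier (add_monoid ?P)" by (auto simp: lin_form_kernel_def)
      have "0 \<in> ?J" using zero_closed by (simp add: lin_form_kernel_def ops)
      then show "?J \<noteq> {}" by auto
      show "inv\<^bsub>add_monoid ?P\<^esub> f \<in> ?J" if "f \<in> ?J" for f
      proof -
        have "f \<in> carrier ?P" using that by (simp add: lin_form_kernel_def)
        with that a_inv_closed[of f] have "\<ominus>\<^bsub>?P\<^esub> f \<in> ?J"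
          by (simp add: minus lin_form_kernel_def sum_negf)
        then show ?thesis by (simp only: a_inv_def)
      qed
      show "f \<otimes>\<^bsub>add_monoid ?P\<^esub> g \<in> ?J" if "f \<in> ?J" "g \<in> ?J" for f g
        using that a_closed[of f g]
        by (simp add: lin_form_kernel_def ops lookup_add ring_distribs sum.distrib)
    qed
    show "g \<otimes>\<^bsub>?P\<^esub> f \<in> ?J" if "f \<in> ?J" "g \<in> carrier ?P" for f g
      by (rule mult[OF that])
    show "f \<otimes>\<^bsub>?P\<^esub> g \<in> ?J" if "f \<in> ?J" "g \<in> carrier ?P" for f g
    proof -
      have "f \<in> carrier ?P" using that by (simp add: lin_form_kernel_def)
      with mult[OF that] that(2) show ?thesis by (simp add: m_comm)
    qed
  qed (rule ring_axioms)
qed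

text \<open>Over an empty index set the linear condition is vacuous, so
  \<open>lin_form_kernel\<close> becomes the ideal of polynomials without constant term, which
  contains the indeterminates.\<close>

lemma irrelevant_ideal_subset:
  "(irrelevant_ideal n :: ('k::field mpoly) set) \<subseteq>
     {f \<in> carrier (poly_ring n). Poly_Mapping.lookup f 0 = 0}"
proof -
  interpret cring "poly_ring n :: ('k mpoly) ring" by (rule cring_poly_ring)
  have "irrelevant_ideal n \<subseteq> lin_form_kernel n ({} :: nat set) id (\<lambda>_. 0 :: 'k)"
    unfolding irrelevant_ideal_def
  proof (rule genideal_minimal[OF ideal_lin_form_kernel])
    show "indet ` {..<n} \<subseteq> lin_form_kernel n ({} :: nat set) id (\<lambda>_. 0 :: 'k)"
      by (auto simp: lin_form_kernel_def poly_ring_def indet_def lookup_single when_def)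
  qed
  then show ?thesis by (auto simp: lin_form_kernel_def)
qed

text \<open>Supplies the finite spanning set that makes the dimension of \<open>Lin_space I\<close>
  meaningful.\<close>

lemma Lin_in_span_indets:
  assumes "f \<in> carrier (poly_ring n)"
  shows "Lin f \<in> module.span scalar_mult (indet ` {..<n})"
proof -
  interpret vector_space "scalar_mult :: 'a \<Rightarrow> 'a mpoly \<Rightarrow> 'a mpoly"
    by (rule vector_space_scalar_mult)
  have "Poly_Mapping.single t (Poly_Mapping.lookup f t) \<in> span (indet ` {..<n})"
    if t: "t \<in> Poly_Mapping.keys f" "pp_degree t = 1" for t
  proof -
    obtain j where j: "t = indet_pp j" using t(2) pp_degree_eq_1_iff by auto
    then have "j < n" using assms t(1) by (auto simp: poly_ring_def)
    have "Poly_Mapping.single t (Poly_Mapping.lookup f t) =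
        scalar_mult (Poly_Mapping.lookup f t) (indet j)"
      by (rule poly_mapping_eqI) (simp add: j indet_def lookup_scalar_mult lookup_single when_def)
    then show ?thesis using \<open>j < n\<close> by (auto intro: span_scale span_base)
  qed
  then show ?thesis
    unfolding Lin_def hom_component_def by (intro span_sum) auto
qed

section \<open>Separating tuples\<close>

text \<open>The definite description in \<open>LT\<close> is justified here: a finite nonempty
  support has a greatest element by totality, unique by antisymmetry.\<close>

lemma LT_greatest:
  assumes "term_ordering n \<sigma>" "f \<in> carrier (poly_ring n)" "f \<noteq> 0"
  shows "LT \<sigma> f \<in> Poly_Mapping.keys f" "s \<in> Poly_Mapping.keys f \<Longrightarrow> (s, LT \<sigma> f) \<in> \<sigma>"
proof -
  let ?K = "Poly_Mapping.keys f"
  have sub: "?K \<subseteq> power_products n" using assms(2) by (simp add: poly_ring_def)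
  have lin: "linear_order_on (power_products n) \<sigma>" using assms(1) by (simp add: term_ordering_def)
  then have refl: "refl_on (power_products n) \<sigma>" and "trans \<sigma>" and anti: "antisym \<sigma>"
    and tot: "total_on (power_products n) \<sigma>"
    by (auto simp: linear_order_on_def partial_order_on_def preorder_on_def)
  let ?R = "\<lambda>s t. (s, t) \<in> \<sigma> \<and> s \<noteq> t"
  have "asymp_on ?K ?R" "transp_on ?K ?R" "totalp_on ?K ?R"
    using \<open>trans \<sigma>\<close> anti tot sub
    unfolding asymp_on_def transp_on_def totalp_on_def total_on_def
    by (blast dest: antisymD transD)+
  then obtain t where t: "t \<in> ?K" "\<And>s. s \<in> ?K \<Longrightarrow> s \<noteq> t \<Longrightarrow> (s, t) \<in> \<sigma>"
    using Finite_Set.bex_greatest_element[of ?K ?R] assms(3) by auto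
  then have "t \<in> ?K \<and> (\<forall>s\<in>?K. (s, t) \<in> \<sigma>)"
    using refl sub by (metis refl_onD subsetD)
  moreover from this have "u = t" if "u \<in> ?K \<and> (\<forall>s\<in>?K. (s, u) \<in> \<sigma>)" for u
    using that anti by (blast dest: antisymD)
  ultimately have "LT \<sigma> f \<in> ?K \<and> (\<forall>s\<in>?K. (s, LT \<sigma> f) \<in> \<sigma>)"
    unfolding LT_def by (rule theI)
  then show "LT \<sigma> f \<in> ?K" "s \<in> ?K \<Longrightarrow> (s, LT \<sigma> f) \<in> \<sigma>" by auto
qed

lemma Z_separating_triangular:
  assumes "Z_separating n zs fs" "distinct zs"
  obtains R where "asymp_on {..<length zs} R" "transp_on {..<length zs} R"
    "\<And>i. i < length zs \<Longrightarrow> Poly_Mapping.lookup (fs ! i) (indet_pp (zs ! i)) \<noteq> 0"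
    "\<And>i j. i < length zs \<Longrightarrow> j < length zs \<Longrightarrow> i \<noteq> j \<Longrightarrow>
       Poly_Mapping.lookup (fs ! i) (indet_pp (zs ! j)) \<noteq> 0 \<Longrightarrow> R j i"
proof -
  obtain \<sigma> where \<sigma>: "term_ordering n \<sigma>"
    and fs: "length fs = length zs" "set fs \<subseteq> carrier (poly_ring n)"
    and LT: "\<And>i. i < length zs \<Longrightarrow> fs ! i \<noteq> 0 \<and> LT \<sigma> (fs ! i) = indet_pp (zs ! i)"
    using assms(1) by (auto simp: Z_separating_def)
  have "trans \<sigma>" "antisym \<sigma>"
    using \<sigma> by (auto simp: term_ordering_def linear_order_on_def partial_order_on_def preorder_on_def)
  \<comment> \<open>The strict term ordering pulled back to indices; distinctness of
    \<open>zs\<close> makes it asymmetric. An indeterminate of \<open>zs\<close> other than the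
    leading one that occurs in \<open>fs ! i\<close> lies below it, hence the triangular
    shape.\<close>
  define R where "R i j \<longleftrightarrow> (indet_pp (zs ! i), indet_pp (zs ! j)) \<in> \<sigma> \<and> i \<noteq> j" for i j
  have max: "indet_pp (zs ! i) \<in> Poly_Mapping.keys (fs ! i)"
    "s \<in> Poly_Mapping.keys (fs ! i) \<Longrightarrow> (s, indet_pp (zs ! i)) \<in> \<sigma>" if "i < length zs" for i s
    using LT_greatest[OF \<sigma>, of "fs ! i"] LT[OF that] fs that by (auto simp: subset_iff)
  have eq: "i = j" if "(indet_pp (zs ! i), indet_pp (zs ! j)) \<in> \<sigma>"
    "(indet_pp (zs ! j), indet_pp (zs ! i)) \<in> \<sigma>" "i < length zs" "j < length zs" for i j
    using antisymD[OF \<open>antisym \<sigma>\<close> that(1,2)] that(3,4) assms(2) by (simp add: nth_eq_iff_index_eq)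
  show ?thesis
  proof
    show "asymp_on {..<length zs} R"
      using eq by (auto simp: asymp_on_def R_def)
    show "transp_on {..<length zs} R"
      using eq \<open>trans \<sigma>\<close> by (auto simp: transp_on_def R_def dest: transD)
  qed (use max in \<open>auto simp: R_def in_keys_iff\<close>)
qed

section \<open>Rank of the submatrix and dimension of the space of linear parts\<close>

theorem proposition2p7:
  fixes n r s :: nat
    and gs :: "('k::field mpoly) list"
    and I :: "('k mpoly) set"
    and zs :: "nat list"
    and A A' :: "'k mat"
  assumes "length gs = r"
    and "set gs \<subseteq> irrelevant_ideal n"
    and "I = Idl\<^bsub>poly_ring n\<^esub> (set gs)"
    and "length zs = s"
    and "distinct zs"
    and "set zs \<subseteq> {..<n}"
    and "A = coeff_mat n (map Lin gs)"
    and "A' = mat_of_cols r (map (col A) zs)"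
    and "separating_tuple n zs I"
  shows "vec_space.rank r A' = s \<and> s \<le> vector_space.dim scalar_mult (Lin_space I)"
proof -
  interpret P: cring "poly_ring n :: ('k mpoly) ring" by (rule cring_poly_ring)
  interpret V: vector_space "scalar_mult :: 'k \<Rightarrow> 'k mpoly \<Rightarrow> 'k mpoly"
    by (rule vector_space_scalar_mult)
  obtain fs where fs: "set fs \<subseteq> I" and sep: "Z_separating n zs fs"
    using assms(9) by (auto simp: separating_tuple_def)
  have len: "length fs = s" using sep assms(4) by (simp add: Z_separating_def)
  define M where "M i j = Poly_Mapping.lookup (fs ! i) (indet_pp (zs ! j))" for i j
  obtain R where R: "asymp_on {..<s} R" "transp_on {..<s} R"
    and diag: "\<And>i. i < s \<Longrightarrow> M i i \<noteq> 0"
    and tri: "\<And>i j. i < s \<Longrightarrow> j < s \<Longrightarrow> i \<noteq> j \<Longrightarrow> M i j \<noteq> 0 \<Longrightarrow> R j i"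
  proof (rule Z_separating_triangular[OF sep assms(5), unfolded assms(4), folded M_def], goal_cases)
    case (1 R)
    show ?case by (rule 1(1)[OF 1(2-)])
  qed
  have gs: "g \<in> carrier (poly_ring n)" "Poly_Mapping.lookup g 0 = 0" if "g \<in> set gs" for g
    using that assms(2) irrelevant_ideal_subset[of n] by auto

  have A': "A' \<in> carrier_mat r s" using assms(4,8) by auto
  have A'_entry: "A' $$ (i, j) = Poly_Mapping.lookup (gs ! i) (indet_pp (zs ! j))"
    if "i < r" "j < s" for i j
  proof -
    \<comment> \<open>The entries of \<open>A\<close> are specified only for column indices below
      \<open>n\<close>.\<close>
    have "zs ! j < n" using that assms(4,6) nth_mem by blast
    then show ?thesis
      using that assms(1,4,7,8) by (simp add: mat_of_cols_index coeff_mat_def)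
  qed
  have "vec_space.rank r A' = s"
  proof (rule vec_space.trivial_kernel_full_rank[OF A'])
    fix v :: "'k vec" assume v: "v \<in> carrier_vec s" and Av: "A' *\<^sub>v v = 0\<^sub>v r"
    \<comment> \<open>Row \<open>i\<close> of \<open>A' *\<^sub>v v = 0\<^sub>v r\<close> says
      exactly that the functional given by \<open>v\<close> kills the linear part of
      \<open>gs ! i\<close>. Passing to the ideal \<open>?J\<close> carries this over to all of
      \<open>I\<close>.\<close>
    let ?J = "lin_form_kernel n {..<s} ((!) zs) (($) v)"
    have "set gs \<subseteq> ?J"
    proof
      fix g assume g: "g \<in> set gs"
      then obtain i where i: "i < r" "g = gs ! i" using assms(1) by (metis in_set_conv_nth)
      have "(\<Sum>j<s. Poly_Mapping.lookup g (indet_pp (zs ! j)) * v $ j) = (A' *\<^sub>v v) $ i"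
        using i A' v A'_entry by (auto simp: scalar_prod_def atLeast0LessThan intro!: sum.cong)
      also have "\<dots> = 0" using Av i by simp
      finally show "g \<in> ?J" using gs[OF g] by (simp add: lin_form_kernel_def)
    qed
    then have "I \<subseteq> ?J"
      unfolding assms(3) by (rule P.genideal_minimal[OF ideal_lin_form_kernel])
    \<comment> \<open>Membership of \<open>fs ! i\<close> in \<open>?J\<close> makes
      \<open>v\<close> a kernel vector of the triangular matrix \<open>M\<close>.\<close>
    then have "(\<Sum>j<s. M i j * v $ j) = 0" if "i < s" for i
      using fs len that nth_mem[of i fs] by (auto simp: lin_form_kernel_def M_def subset_iff)
    then have "v $ i = 0" if "i < s" for i
      using triangular_kernel[OF _ R, of M "($) v" i] diag tri that by auto
    then show "v = 0\<^sub>v s" using v by (intro eq_vecI) auto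
  qed

  moreover have "s \<le> V.dim (Lin_space I)"
  proof -
    let ?f = "\<lambda>i. Lin (fs ! i)"
    have rel: "c i = 0" if "(\<Sum>i<s. scalar_mult (c i) (?f i)) = 0" "i \<in> {..<s}" for c i
    \<comment> \<open>Comparing coefficients at each \<open>zs ! j\<close> puts \<open>c\<close>
      into the kernel of the transpose of \<open>M\<close>, which is triangular for the converse
      order.\<close>
    proof (rule triangular_kernel[where S = "{..<s}" and R = "\<lambda>i j. R j i"
          and M = "\<lambda>j i. M i j"])
      show "asymp_on {..<s} (\<lambda>i j. R j i)" "transp_on {..<s} (\<lambda>i j. R j i)"
        using R unfolding asymp_on_def transp_on_def by blast+
      show "(\<Sum>i<s. M i j * c i) = 0" for j
        using arg_cong[OF that(1), of "\<lambda>p. Poly_Mapping.lookup p (indet_pp (zs ! j))"]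
        by (simp add: lookup_sum lookup_scalar_mult M_def mult.commute)
    qed (use diag tri that(2) in simp_all)
    have ind: "inj_on ?f {..<s}" "V.independent (?f ` {..<s})"
      by (rule V.independent_family[OF finite_lessThan]; erule (1) rel)+
    have I: "I \<subseteq> carrier (poly_ring n)"
    proof
      fix f assume "f \<in> I"
      moreover have "ideal I (poly_ring n)"
        unfolding assms(3) by (rule P.genideal_ideal) (use gs(1) in auto)
      ultimately show "f \<in> carrier (poly_ring n)" by (rule ideal.Icarr[rotated])
    qed
    have "card (?f ` {..<s}) \<le> V.dim (Lin_space I)"
    proof (rule V.card_le_dim[OF ind(2)])
      show "?f ` {..<s} \<subseteq> Lin_space I"
        using fs len by (auto simp: Lin_space_def intro!: V.span_base imageI)
      show "Lin_space I \<subseteq> V.span (indet ` {..<n})"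
        unfolding Lin_space_def using I
        by (intro V.span_minimal V.subspace_span) (auto intro: Lin_in_span_indets)
    qed simp
    then show ?thesis using card_image[OF ind(1)] by simp
  qed
  ultimately show ?thesis by blast
qed

end
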